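(* Let $n\ge 2$ be an integer, let $\lambda\in\mathbb{C}$ with $|\lambda|=1$, let $c\in\mathbb{D}$, and let $$B(z)=\lambda\frac{z^n-c^n}{1-\overline{c}^{\,n}z^n},$$ a Blaschke product of degree $n$ whose zeros are equally spaced on a circle centered at $0$. Define $\varphi(z)=\dfrac{e^{i\pi/n}z}{\sqrt[n]{1-\overline{c}^{\,n}z^n}}$ for $z\in\mathbb{D}$. Then $\varphi$ is analytic and injective on $\mathbb{D}$, and for all $z\in\mathbb{D}$, $$B(\varphi(z))=\lambda\left(|c|^{2n}-1\right)z^n-\lambda c^n.$$ Moreover, the polynomial $p(z)=\lambda\left(|c|^{2n}-1\right)z^n-\lambda c^n$ on the set $\varphi(\mathbb{D})$ is a conformal model for $B$ on $\mathbb{D}$.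
   Context: $\mathbb{D}$ is the open unit disk in $\mathbb{C}$. For domains $D,E\subset\mathbb{C}$ and analytic functions $f:D\to\mathbb{C}$, $g:E\to\mathbb{C}$, one says that $g$ on $E$ is a conformal model for $f$ on $D$ if there is an analytic bijection $\psi:D\to E$ such that $f=g\circ\psi$ on $D$. In the expression $B(\varphi(z))$, $B$ is regarded as a rational function on $\mathbb{C}$, since $\varphi(z)$ need not lie in $\mathbb{D}$. The symbol $\sqrt[n]{\cdot}$ denotes the principal branch of the $n$-th root, which is analytic at $1-\overline{c}^{\,n}z^n$ for $z\in\mathbb{D}$ because this number has positive real part. *)

theory Defs
  imports "HOL-Complex_Analysis.Complex_Analysis"
begin

abbreviation unit_disk :: "complex set"  (\<open>\<bbbD>\<close>) where
  "\<bbbD> \<equiv> ball 0 1"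

definition is_domain :: "complex set \<Rightarrow> bool" where
  "is_domain D \<longleftrightarrow> open D \<and> connected D \<and> D \<noteq> {}"

text \<open>\<open>g\<close> on \<open>E\<close> is a conformal model for \<open>f\<close> on \<open>D\<close>. The standing assumptions (domains, analytic
  functions) are part of the predicate, so asserting it also asserts that \<open>E\<close> is a domain.\<close>

definition conformal_model ::
    "(complex \<Rightarrow> complex) \<Rightarrow> complex set \<Rightarrow> (complex \<Rightarrow> complex) \<Rightarrow> complex set \<Rightarrow> bool" where
  "conformal_model g E f D \<longleftrightarrow>
     is_domain D \<and> is_domain E \<and> f analytic_on D \<and> g analytic_on E \<and>
     (\<exists>\<psi>. \<psi> analytic_on D \<and> bij_betw \<psi> D E \<and> (\<forall>z\<in>D. f z = g (\<psi> z)))"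

definition blaschke_denom :: "nat \<Rightarrow> complex \<Rightarrow> complex \<Rightarrow> complex" where
  "blaschke_denom n c z = 1 - cnj c ^ n * z ^ n"

text \<open>A rational function on the plane; at its poles, i.e. the zeros of the denominator,
  HOL division gives the junk value 0.\<close>

definition blaschke :: "nat \<Rightarrow> complex \<Rightarrow> complex \<Rightarrow> complex \<Rightarrow> complex" where
  "blaschke n l c z = l * ((z ^ n - c ^ n) / blaschke_denom n c z)"

text \<open>Complex \<open>powr\<close> is defined through the principal logarithm, so \<open>w powr (1 / n)\<close> is the
  principal \<open>n\<close>-th root.\<close>

definition phi :: "nat \<Rightarrow> complex \<Rightarrow> complex \<Rightarrow> complex" where
  "phi n c z = exp (\<i> * of_real pi / of_nat n) * z /
     ((1 - cnj c ^ n * z ^ n) powr (1 / of_nat n))"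

definition model_poly :: "nat \<Rightarrow> complex \<Rightarrow> complex \<Rightarrow> complex \<Rightarrow> complex" where
  "model_poly n l c z = l * of_real (cmod c ^ (2 * n) - 1) * z ^ n - l * c ^ n"

end

theory Submission
  imports Defs
begin

text \<open>Write \<open>D = 1 - cnj c ^ n * z ^ n\<close>. Since \<open>exp (\<i> * pi / n) ^ n = -1\<close>, the function \<open>\<phi>\<close> satisfies
  \<open>\<phi>(z) ^ n = - z ^ n / D\<close>, and hence \<open>1 - cnj c ^ n * \<phi>(z) ^ n = 1 / D\<close>. Both identities
  \<open>B \<circ> \<phi> = p\<close> and \<open>p \<circ> \<phi> = B\<close> follow, so \<open>\<phi>\<close> itself is the conformal map of the model.
  The value \<open>\<phi>(z) ^ n\<close> determines \<open>z ^ n\<close>, hence \<open>D\<close>, hence the root in the denominator of \<open>\<phi>\<close>;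
  so \<open>\<phi>(z)\<close> determines \<open>z\<close>.\<close>

text \<open>Holds on the branch cut too, since \<open>exp (Ln w / n) ^ n = exp (Ln w) = w\<close>;
  at \<open>w = 0\<close> the convention \<open>0 powr a = 0\<close> gives both sides 0.\<close>

lemma powr_inverse_nat_power:
  fixes w :: complex
  assumes "n > 0"
  shows "(w powr (1 / of_nat n)) ^ n = w"
  using assms by (cases "w = 0") (simp_all add: powr_def flip: exp_of_nat_mult)

text \<open>Because \<open>cmod (c * z) ^ n < 1\<close>. This keeps the denominator away from 0 and
  off the cut of the principal root.\<close>

lemma Re_blaschke_denom_pos:
  assumes "n > 0" "c \<in> \<bbbD>" "z \<in> \<bbbD>"
  shows "Re (blaschke_denom n c z) > 0"
proof -
  have "cmod (c * z) < 1"
    using assms(2,3) mult_strict_mono'[of "cmod c" 1 "cmod z" 1] by (simp add: norm_mult)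
  then have "cmod (cnj c ^ n * z ^ n) < 1"
    using assms(1) power_strict_mono[of "cmod (c * z)" 1 n]
    by (simp add: norm_mult norm_power power_mult_distrib)
  then show ?thesis
    using complex_Re_le_cmod[of "cnj c ^ n * z ^ n"] by (simp add: blaschke_denom_def)
qed

lemma blaschke_denom_nonzero:
  assumes "n > 0" "c \<in> \<bbbD>" "z \<in> \<bbbD>"
  shows "blaschke_denom n c z \<noteq> 0"
  using Re_blaschke_denom_pos[OF assms] by auto

lemma blaschke_holomorphic_on:
  assumes "n > 0" "c \<in> \<bbbD>"
  shows "blaschke n l c holomorphic_on \<bbbD>"
  unfolding blaschke_def using blaschke_denom_nonzero[OF assms]
  by (auto simp: blaschke_denom_def intro!: holomorphic_intros)

lemma phi_holomorphic_on:
  assumes "n > 0" "c \<in> \<bbbD>"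
  shows "phi n c holomorphic_on \<bbbD>"
proof -
  have "1 - cnj c ^ n * z ^ n \<notin> \<real>\<^sub>\<le>\<^sub>0 \<and> 1 - cnj c ^ n * z ^ n \<noteq> 0" if "z \<in> \<bbbD>" for z
    using Re_blaschke_denom_pos[OF assms that] blaschke_denom_nonzero[OF assms that]
    unfolding blaschke_denom_def complex_nonpos_Reals_iff by linarith
  then show ?thesis
    unfolding phi_def by (auto intro!: holomorphic_intros)
qed

text \<open>Stated on the whole plane: at a zero of the denominator both sides are 0 by the
  conventions for \<open>powr\<close> and division.\<close>

lemma phi_power:
  assumes "n > 0"
  shows "phi n c z ^ n = - (z ^ n / blaschke_denom n c z)"
proof -
  have "exp (\<i> * of_real pi / of_nat n) ^ n = (-1 :: complex)"
    using assms by (simp flip: exp_of_nat_mult)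
  then show ?thesis
    by (simp add: phi_def blaschke_denom_def power_divide power_mult_distrib
        powr_inverse_nat_power[OF assms])
qed

lemma phi_inj_on:
  assumes "n > 0" "c \<in> \<bbbD>"
  shows "inj_on (phi n c) \<bbbD>"
proof (rule inj_onI)
  fix z w
  assume z: "z \<in> \<bbbD>" and w: "w \<in> \<bbbD>" and eq: "phi n c z = phi n c w"
  note nz = blaschke_denom_nonzero[OF assms z] blaschke_denom_nonzero[OF assms w]
  have "z ^ n / blaschke_denom n c z = w ^ n / blaschke_denom n c w"
    using phi_power[OF assms(1)] eq by (metis neg_equal_iff_equal)
  then have "z ^ n = w ^ n"
    \<comment> \<open>After cross-multiplication the mixed terms
      \<open>cnj c ^ n * z ^ n * w ^ n\<close> cancel.\<close>
    using nz by (simp add: frac_eq_eq) (simp add: blaschke_denom_def algebra_simps)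
  then show "z = w"
    using eq nz by (simp add: phi_def blaschke_denom_def)
qed

lemma blaschke_denom_phi:
  assumes "n > 0" "c \<in> \<bbbD>" "z \<in> \<bbbD>"
  shows "blaschke_denom n c (phi n c z) = 1 / blaschke_denom n c z"
proof -
  have "blaschke_denom n c (phi n c z) = 1 + cnj c ^ n * z ^ n / blaschke_denom n c z"
    unfolding blaschke_denom_def[of n c "phi n c z"] phi_power[OF assms(1)] by simp
  also have "\<dots> = 1 / blaschke_denom n c z"
    using blaschke_denom_nonzero[OF assms] by (simp add: field_simps) (simp add: blaschke_denom_def)
  finally show ?thesis .
qed

text \<open>Puts the leading coefficient of \<open>model_poly\<close> in terms of
  \<open>c ^ n\<close> and \<open>cnj c ^ n\<close>, so that it can be compared algebraically with
  the denominator.\<close>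

lemma of_real_cmod_power_double: "of_real (cmod c ^ (2 * n)) = c ^ n * cnj c ^ n"
  by (simp only: power_mult of_real_power complex_norm_square[unfolded of_real_power] power_mult_distrib)

lemma blaschke_phi:
  assumes "n > 0" "c \<in> \<bbbD>" "z \<in> \<bbbD>"
  shows "blaschke n l c (phi n c z) = model_poly n l c z"
proof -
  note nz = blaschke_denom_nonzero[OF assms]
  have "blaschke n l c (phi n c z) = l * (- (z ^ n) - c ^ n * blaschke_denom n c z)"
    using nz unfolding blaschke_def blaschke_denom_phi[OF assms] phi_power[OF assms(1)]
    by (simp add: field_simps)
  also have "\<dots> = model_poly n l c z"
    unfolding model_poly_def blaschke_denom_def of_real_diff of_real_cmod_power_double
    by (simp add: algebra_simps)
  finally show ?thesis .
qed

lemma model_poly_phi: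
  assumes "n > 0" "c \<in> \<bbbD>" "z \<in> \<bbbD>"
  shows "model_poly n l c (phi n c z) = blaschke n l c z"
proof -
  note nz = blaschke_denom_nonzero[OF assms]
  have "model_poly n l c (phi n c z)
      = l * (((1 - c ^ n * cnj c ^ n) * z ^ n - c ^ n * blaschke_denom n c z) / blaschke_denom n c z)"
    using nz unfolding model_poly_def phi_power[OF assms(1)] of_real_diff of_real_cmod_power_double
    by (simp add: field_simps)
  also have "(1 - c ^ n * cnj c ^ n) * z ^ n - c ^ n * blaschke_denom n c z = z ^ n - c ^ n"
    by (simp add: blaschke_denom_def algebra_simps)
  finally show ?thesis
    by (simp add: blaschke_def)
qed

text \<open>Openness comes from the open mapping theorem for injective holomorphic maps,
  connectedness from continuity.\<close>

lemma is_domain_injective_image: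
  assumes "is_domain D" "f holomorphic_on D" "inj_on f D"
  shows "is_domain (f ` D)"
  using assms open_mapping_thm3[of f D]
  by (auto simp: is_domain_def intro: connected_continuous_image holomorphic_on_imp_continuous_on)

theorem mainTheorem2:
  fixes n :: nat and l c :: complex
  assumes "n \<ge> 2" and "cmod l = 1" and "c \<in> \<bbbD>"
  shows "phi n c analytic_on \<bbbD> \<and> inj_on (phi n c) \<bbbD>
    \<and> (\<forall>z\<in>\<bbbD>. blaschke_denom n c (phi n c z) \<noteq> 0
          \<and> blaschke n l c (phi n c z) = l * of_real (cmod c ^ (2 * n) - 1) * z ^ n - l * c ^ n)
    \<and> conformal_model (model_poly n l c) (phi n c ` \<bbbD>) (blaschke n l c) \<bbbD>"
proof (intro conjI ballI)
  have n: "n > 0" using assms(1) by simp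
  note hol = phi_holomorphic_on[OF n assms(3)] and inj = phi_inj_on[OF n assms(3)]
  show an: "phi n c analytic_on \<bbbD>"
    using hol by (simp add: analytic_on_open)
  show "inj_on (phi n c) \<bbbD>" by (rule inj)
  \<comment> \<open>The denominator at \<open>phi n c z\<close> is a reciprocal of a nonzero number,
    so \<open>phi n c z\<close> avoids the poles of the rational function, where division would
    return the default 0.\<close>
  show "blaschke_denom n c (phi n c z) \<noteq> 0" if "z \<in> \<bbbD>" for z
    using blaschke_denom_phi[OF n assms(3) that] blaschke_denom_nonzero[OF n assms(3) that] by simp
  show "blaschke n l c (phi n c z) = l * of_real (cmod c ^ (2 * n) - 1) * z ^ n - l * c ^ n"
    if "z \<in> \<bbbD>" for z
    using blaschke_phi[OF n assms(3) that] by (simp add: model_poly_def)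
  have disk: "is_domain \<bbbD>"
    by (simp add: is_domain_def)
  have "model_poly n l c analytic_on phi n c ` \<bbbD>"
    unfolding model_poly_def by (intro analytic_intros)
  moreover have "blaschke n l c analytic_on \<bbbD>"
    using blaschke_holomorphic_on[OF n assms(3)] by (simp add: analytic_on_open)
  moreover have "\<forall>z\<in>\<bbbD>. blaschke n l c z = model_poly n l c (phi n c z)"
    using model_poly_phi[OF n assms(3)] by simp
  ultimately show "conformal_model (model_poly n l c) (phi n c ` \<bbbD>) (blaschke n l c) \<bbbD>"
    unfolding conformal_model_def
    using disk is_domain_injective_image[OF disk hol inj] an inj_on_imp_bij_betw[OF inj] by blast
qed

end
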